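(* Let $f\in\mathcal{C}^1(\mathbb{R}^d;\mathbb{R}^d)$ and $g\in\mathcal{C}^1(\mathbb{R}^d;\mathbb{R}^{d\times m})$, and suppose there are $\mu\in\mathbb{R}$ and $L>0$ such that $$\langle x-y,f(x)-f(y)\rangle\le\mu|x-y|^2,\qquad |g(x)-g(y)|^2\le L|x-y|^2\qquad\forall x,y\in\mathbb{R}^d,$$ with $\alpha=2\mu+L<0$. Let $\theta\in[0,1]$, and let $$\mathcal{R}=\begin{cases}\left(0,\dfrac{|\alpha|}{(1-\theta)^2M}\right),&\theta<1,\\[3mm]\mathbb{R}^+,&\theta=1,\end{cases}\qquad M=\sup_{t\in[0,T]}\mathbb{E}|f'(X(t))|^2,$$ where $X(t)$ is the solution of the It\^o SDE $dX(t)=f(X(t))dt+g(X(t))dW(t)$, $t\in[0,T]$, $X(0)=X_0$, $\mathbb{E}|X_0|^2<\infty$. Then $0<\beta(\theta,\Delta t)<1$ for every $\Delta t\in\mathcal{R}$; that is, the $\theta$-Maruyama method $$X_{n+1}=X_n+(1-\theta)\Delta t f(X_n)+\theta\Delta t f(X_{n+1})+g(X_n)\Delta W_n$$ generates mean-square contractive numerical solutions in the region $\mathcal{R}$.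
   Context: $W(t)$ is an $m$-dimensional Wiener process. $|\cdot|$ denotes the Euclidean norm on $\mathbb{R}^d$ and the trace (Frobenius) norm on matrices; $\langle\cdot,\cdot\rangle$ is the Euclidean inner product; $f'$ is the Jacobian of $f$; $\mathbb{R}^+=(0,\infty)$. $\Delta W_n=W(t_{n+1})-W(t_n)$ with $t_n=n\Delta t$. Define $$\beta(\theta,\Delta t)=1+\frac{\alpha+(1-\theta)^2M\Delta t}{1-2\theta\mu\Delta t}\,\Delta t,\qquad \nu(\theta,\Delta t)=\frac1{\Delta t}\ln\beta(\theta,\Delta t).$$ ($\nu(\theta,\Delta t)$ is the exponent in the stability inequality $\mathbb{E}|X_n-Y_n|^2\le\mathbb{E}|X_0-Y_0|^2e^{\nu(\theta,\Delta t)t_n}$ for two numerical solutions of the method.) For fixed $\theta\in[0,1]$, the $\theta$-Maruyama method is said to generate mean-square contractive numerical solutions in a region $\mathcal{R}\subseteq\mathbb{R}^+$ if $\nu(\theta,\Delta t)<0$ for all $\Delta t\in\mathcal{R}$. Standing assumption: the SDE is commutative, i.e. $L^{j_1}g^{j_2}=L^{j_2}g^{j_1}$ for all $j_1,j_2$, where $g^j$ is the $j$-th column of $g$ and $L^j=\sum_{k=1}^d g^{k,j}\frac{\partial}{\partial x^k}$. *)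

theory Defs
  imports "HOL-Probability.Probability"
begin

section \<open>Coefficients\<close>

definition C1 :: "('a::real_normed_vector \<Rightarrow> 'b::real_normed_vector) \<Rightarrow> bool" where
  "C1 f \<longleftrightarrow> (\<exists>f' :: 'a \<Rightarrow> 'a \<Rightarrow>\<^sub>L 'b.
     (\<forall>x. (f has_derivative blinfun_apply (f' x)) (at x)) \<and> continuous_on UNIV f')"

text \<open>\<open>diff_op g j h x\<close> is \<open>(L\<^sup>j h)(x)\<close>, where
  \<open>L\<^sup>j = (\<Sum>k. g\<^sup>k\<^sup>,\<^sup>j \<partial>/\<partial>x\<^sup>k)\<close>; the partial derivative is the directional
  derivative along the \<open>k\<close>-th unit vector.\<close>

definition diff_op ::
  "(real^'d \<Rightarrow> real^'m^'d) \<Rightarrow> 'm \<Rightarrow> (real^'d \<Rightarrow> real^'d) \<Rightarrow> real^'d \<Rightarrow> real^'d" where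
  "diff_op g j h x = (\<Sum>k\<in>UNIV. (g x $ k $ j) *\<^sub>R frechet_derivative h (at x) (axis k 1))"

definition commutative_noise :: "(real^'d::finite \<Rightarrow> real^'m::finite^'d) \<Rightarrow> bool" where
  "commutative_noise g \<longleftrightarrow>
     (\<forall>j1 j2. diff_op g j1 (\<lambda>x. column j2 (g x)) = diff_op g j2 (\<lambda>x. column j1 (g x)))"


section \<open>Wiener process\<close>

text \<open>The time index is \<open>real\<close>, but only times \<open>t \<ge> 0\<close> matter: a filtration on the half line
  is extended by \<open>F t = F 0\<close> for \<open>t < 0\<close>.\<close>

locale wiener_process =
  prob_space P + filtration "space P" F
  for P :: "'w measure" and F :: "real \<Rightarrow> 'w measure" +
  fixes W :: "real \<Rightarrow> 'w \<Rightarrow> real^'m::finite"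
  assumes filtration_sub: "\<And>t. sets (F t) \<subseteq> sets P"
    and adapted: "\<And>t. 0 \<le> t \<Longrightarrow> W t \<in> borel_measurable (F t)"
    and start: "AE \<omega> in P. W 0 \<omega> = 0"
    and continuous_paths: "AE \<omega> in P. continuous_on {0..} (\<lambda>t. W t \<omega>)"
    and increment_indep: "\<And>s t. 0 \<le> s \<Longrightarrow> s < t \<Longrightarrow>
      indep_set (sets (F s)) {(\<lambda>\<omega>. W t \<omega> - W s \<omega>) -` A \<inter> space P | A. A \<in> sets borel}"
    and components_indep: "\<And>s t. 0 \<le> s \<Longrightarrow> s < t \<Longrightarrow>
      indep_vars (\<lambda>_. borel) (\<lambda>j \<omega>. (W t \<omega> - W s \<omega>) $ j) UNIV"
    and increment_normal: "\<And>s t j. 0 \<le> s \<Longrightarrow> s < t \<Longrightarrow>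
      distributed P lborel (\<lambda>\<omega>. (W t \<omega> - W s \<omega>) $ j) (normal_density 0 (sqrt (t - s)))"


section \<open>Ito integral and Ito SDEs\<close>

definition progressively_measurable ::
  "(real \<Rightarrow> 'w measure) \<Rightarrow> real \<Rightarrow> (real \<Rightarrow> 'w \<Rightarrow> 'b::topological_space) \<Rightarrow> bool" where
  "progressively_measurable F T H \<longleftrightarrow>
     (\<forall>t\<in>{0..T}. (\<lambda>(s, \<omega>). H s \<omega>) \<in> borel_measurable (restrict_space borel {0..t} \<Otimes>\<^sub>M F t))"

text \<open>A simple process on \<open>[0,T]\<close> takes the bounded, \<open>F (\<tau> k)\<close>-measurable matrix value
  \<open>\<xi> k\<close> on \<open>[\<tau> k, \<tau> (k + 1))\<close>, where \<open>0 = \<tau> 0 < ... < \<tau> N = T\<close>.\<close>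

definition simple_process ::
  "'w measure \<Rightarrow> (real \<Rightarrow> 'w measure) \<Rightarrow> real \<Rightarrow> nat \<Rightarrow> (nat \<Rightarrow> real) \<Rightarrow>
   (nat \<Rightarrow> 'w \<Rightarrow> real^'m::finite^'d::finite) \<Rightarrow> bool" where
  "simple_process P F T N \<tau> \<xi> \<longleftrightarrow>
     \<tau> 0 = 0 \<and> \<tau> N = T \<and> (\<forall>k<N. \<tau> k < \<tau> (Suc k)) \<and>
     (\<forall>k<N. \<xi> k \<in> borel_measurable (F (\<tau> k)) \<and> (\<exists>C. \<forall>\<omega>\<in>space P. norm (\<xi> k \<omega>) \<le> C))"

definition simple_value ::
  "nat \<Rightarrow> (nat \<Rightarrow> real) \<Rightarrow> (nat \<Rightarrow> 'w \<Rightarrow> real^'m::finite^'d::finite) \<Rightarrow>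
   real \<Rightarrow> 'w \<Rightarrow> real^'m^'d" where
  "simple_value N \<tau> \<xi> t \<omega> = (\<Sum>k<N. indicator {\<tau> k..<\<tau> (Suc k)} t *\<^sub>R \<xi> k \<omega>)"

definition simple_integral_upto ::
  "(real \<Rightarrow> 'w \<Rightarrow> real^'m::finite) \<Rightarrow> nat \<Rightarrow> (nat \<Rightarrow> real) \<Rightarrow>
   (nat \<Rightarrow> 'w \<Rightarrow> real^'m^'d::finite) \<Rightarrow> real \<Rightarrow> 'w \<Rightarrow> real^'d" where
  "simple_integral_upto W N \<tau> \<xi> t \<omega> =
     (\<Sum>k<N. \<xi> k \<omega> *v (W (min t (\<tau> (Suc k))) \<omega> - W (min t (\<tau> k)) \<omega>))"

text \<open>\<open>I t\<close> is (a version of) the Ito integral of \<open>H\<close> against \<open>W\<close> over \<open>[0,t]\<close>: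
  simple processes \<open>H\<^sub>n\<close> with \<open>\<integral>\<^sub>0\<^sup>T |H\<^sub>n - H|\<^sup>2 ds \<rightarrow> 0\<close> in probability have integrals
  converging to \<open>I t\<close> in probability. This covers every progressively measurable \<open>H\<close> with
  \<open>\<integral>\<^sub>0\<^sup>T |H|\<^sup>2 ds < \<infinity>\<close> almost surely, and the limit does not depend on the \<open>H\<^sub>n\<close>.
  Measurability of \<open>H\<close> and \<open>I t\<close> is required because \<open>measure\<close> is 0 on non-measurable sets.\<close>

definition has_ito_integral ::
  "'w measure \<Rightarrow> (real \<Rightarrow> 'w measure) \<Rightarrow> (real \<Rightarrow> 'w \<Rightarrow> real^'m::finite) \<Rightarrow> real \<Rightarrow>
   (real \<Rightarrow> 'w \<Rightarrow> real^'m^'d::finite) \<Rightarrow> (real \<Rightarrow> 'w \<Rightarrow> real^'d) \<Rightarrow> bool" where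
  "has_ito_integral P F W T H I \<longleftrightarrow>
     progressively_measurable F T H \<and>
     (\<forall>t\<in>{0..T}. I t \<in> borel_measurable P) \<and>
     (\<exists>N \<tau> \<xi>.
        (\<forall>n. simple_process P F T (N n) (\<tau> n) (\<xi> n)) \<and>
        (\<forall>\<epsilon>>0. (\<lambda>n. measure P {\<omega>\<in>space P.
            (\<integral>\<^sup>+s\<in>{0..T}. ennreal ((norm (simple_value (N n) (\<tau> n) (\<xi> n) s \<omega> - H s \<omega>))\<^sup>2) \<partial>lborel)
              > ennreal \<epsilon>}) \<longlonglongrightarrow> 0) \<and>
        (\<forall>t\<in>{0..T}. \<forall>\<epsilon>>0. (\<lambda>n. measure P {\<omega>\<in>space P.
            norm (simple_integral_upto W (N n) (\<tau> n) (\<xi> n) t \<omega> - I t \<omega>) > \<epsilon>}) \<longlonglongrightarrow> 0))"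

definition ito_sde_solution ::
  "'w measure \<Rightarrow> (real \<Rightarrow> 'w measure) \<Rightarrow> (real \<Rightarrow> 'w \<Rightarrow> real^'m::finite) \<Rightarrow>
   (real^'d::finite \<Rightarrow> real^'d) \<Rightarrow> (real^'d \<Rightarrow> real^'m^'d) \<Rightarrow> real \<Rightarrow>
   ('w \<Rightarrow> real^'d) \<Rightarrow> (real \<Rightarrow> 'w \<Rightarrow> real^'d) \<Rightarrow> bool" where
  "ito_sde_solution P F W f g T X0 X \<longleftrightarrow>
     X0 \<in> borel_measurable (F 0) \<and>
     progressively_measurable F T X \<and>
     (AE \<omega> in P. continuous_on {0..T} (\<lambda>t. X t \<omega>)) \<and>
     (AE \<omega> in P. X 0 \<omega> = X0 \<omega>) \<and>
     (\<exists>I. has_ito_integral P F W T (\<lambda>t \<omega>. g (X t \<omega>)) I \<and>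
       (\<forall>t\<in>{0..T}. AE \<omega> in P.
          X t \<omega> = X0 \<omega> + (LINT s:{0..t}|lborel. f (X s \<omega>)) + I t \<omega>))"


section \<open>Mean-square contractivity of the theta-Maruyama method\<close>

text \<open>\<open>M = sup\<^bsub>t \<in> [0,T]\<^esub> E |f'(X(t))|\<^sup>2\<close> with the Frobenius norm, which is the norm of
  \<open>real^'d^'d\<close>. Nothing excludes \<open>M = \<infinity>\<close> a priori, hence the extended reals below;
  there \<open>0 * \<infinity> = 0\<close>, \<open>a / \<infinity> = 0\<close> and \<open>a / 0 = \<infinity>\<close> for real \<open>a > 0\<close>.\<close>

definition jacobian_moment ::
  "'w measure \<Rightarrow> (real^'d::finite \<Rightarrow> real^'d) \<Rightarrow> real \<Rightarrow> (real \<Rightarrow> 'w \<Rightarrow> real^'d) \<Rightarrow> ereal" where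
  "jacobian_moment P f T X =
     enn2ereal (SUP t\<in>{0..T}. \<integral>\<^sup>+\<omega>. ennreal ((norm (jacobian f (at (X t \<omega>))))\<^sup>2) \<partial>P)"

definition beta :: "real \<Rightarrow> real \<Rightarrow> ereal \<Rightarrow> real \<Rightarrow> real \<Rightarrow> ereal" where
  "beta \<alpha> \<mu> M \<theta> \<Delta>t =
     1 + (ereal \<alpha> + ereal ((1 - \<theta>)\<^sup>2) * M * ereal \<Delta>t) / ereal (1 - 2 * \<theta> * \<mu> * \<Delta>t) * ereal \<Delta>t"

text \<open>The logarithm on \<open>(0,\<infinity>]\<close>.\<close>

definition ln_ereal :: "ereal \<Rightarrow> ereal" where
  "ln_ereal x = (if x = \<infinity> then \<infinity> else ereal (ln (real_of_ereal x)))"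

definition nu :: "real \<Rightarrow> real \<Rightarrow> ereal \<Rightarrow> real \<Rightarrow> real \<Rightarrow> ereal" where
  "nu \<alpha> \<mu> M \<theta> \<Delta>t = ereal (1 / \<Delta>t) * ln_ereal (beta \<alpha> \<mu> M \<theta> \<Delta>t)"

text \<open>Contractivity of the method \<open>X\<^sub>n\<^sub>+\<^sub>1 = X\<^sub>n + (1-\<theta>) \<Delta>t f(X\<^sub>n) + \<theta> \<Delta>t f(X\<^sub>n\<^sub>+\<^sub>1) + g(X\<^sub>n) \<Delta>W\<^sub>n\<close> is by
  definition a condition on \<open>nu\<close>, the exponent of its mean-square stability estimate, so the
  recursion itself does not occur.
  The conjunct \<open>0 < beta\<close> says that \<open>nu\<close> is defined; HOL's \<open>ln\<close> is total and would
  otherwise also give negative values of \<open>nu\<close> for \<open>beta\<close> in \<open>(-1,0)\<close>.\<close>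

definition theta_maruyama_ms_contractive ::
  "real \<Rightarrow> real \<Rightarrow> ereal \<Rightarrow> real \<Rightarrow> real set \<Rightarrow> bool" where
  "theta_maruyama_ms_contractive \<alpha> \<mu> M \<theta> R \<longleftrightarrow>
     R \<subseteq> {0<..} \<and> (\<forall>\<Delta>t\<in>R. 0 < beta \<alpha> \<mu> M \<theta> \<Delta>t \<and> nu \<alpha> \<mu> M \<theta> \<Delta>t < 0)"

definition contractivity_region :: "real \<Rightarrow> ereal \<Rightarrow> real \<Rightarrow> real set" where
  "contractivity_region \<alpha> M \<theta> =
     (if \<theta> < 1
      then {\<Delta>t. 0 < \<Delta>t \<and> ereal \<Delta>t < ereal \<bar>\<alpha>\<bar> / (ereal ((1 - \<theta>)\<^sup>2) * M)}
      else {0<..})"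

end

theory Submission
  imports Defs
begin

(* One-sided Lipschitz continuity passes to the Jacobian: <v, f'(x) v> <= mu |v|^2. Since mu < 0,
   every diagonal entry of f'(x) is at most mu, so |f'(x)|^2 >= mu^2 and hence M >= mu^2. With
   h = Delta t and alpha = 2 mu + L, positivity of beta then follows from
     (1 - 2 theta mu h) + (alpha + (1 - theta)^2 M h) h >= (1 + (1 - theta) mu h)^2 + L h > 0,
   and beta < 1 says alpha + (1 - theta)^2 M h < 0, which is how the region is defined. *)

text \<open>The bound is tested on the pairs \<open>x + t *\<^sub>R v\<close>, \<open>x\<close>:
  divided by the square of \<open>t\<close> it no longer depends on \<open>t\<close>, so it survives
  the limit of the difference quotient at 0.\<close>

lemma one_sided_lipschitz_derivative:
  fixes f :: "'a::real_inner \<Rightarrow> 'a"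
  assumes lip: "\<And>x y. (x - y) \<bullet> (f x - f y) \<le> \<mu> * (norm (x - y))\<^sup>2"
    and der: "(f has_derivative D) (at x)"
  shows "v \<bullet> D v \<le> \<mu> * (norm v)\<^sup>2"
proof -
  interpret bounded_linear D
    using der by (rule has_derivative_bounded_linear)
  have "((\<lambda>t. x + t *\<^sub>R v) has_derivative (\<lambda>t. t *\<^sub>R v)) (at 0)"
    by (auto intro!: derivative_eq_intros)
  moreover have "(f has_derivative D) (at (x + 0 *\<^sub>R v))"
    using der by simp
  ultimately have "((\<lambda>t. f (x + t *\<^sub>R v)) has_derivative (\<lambda>t. D (t *\<^sub>R v))) (at 0)"
    by (rule has_derivative_compose)
  then have "((\<lambda>t. v \<bullet> f (x + t *\<^sub>R v)) has_derivative (\<lambda>t. v \<bullet> D (t *\<^sub>R v))) (at 0)"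
    by (rule has_derivative_inner_right)
  then have "((\<lambda>t. v \<bullet> f (x + t *\<^sub>R v)) has_field_derivative v \<bullet> D v) (at 0)"
    by (simp add: has_field_derivative_def scaleR mult_commute_abs)
  then have "((\<lambda>t. v \<bullet> ((f (x + t *\<^sub>R v) - f x) /\<^sub>R t)) \<longlongrightarrow> v \<bullet> D v) (at 0)"
    by (simp add: DERIV_def inner_diff_right divide_inverse mult.commute right_diff_distrib)
  moreover have "v \<bullet> ((f (x + t *\<^sub>R v) - f x) /\<^sub>R t) \<le> \<mu> * (norm v)\<^sup>2" if "t \<noteq> 0" for t
  proof -
    \<comment> \<open>Scaling by the square of \<open>t\<close>, not by \<open>t\<close>, keeps the
      inequality for both signs of \<open>t\<close>, as the two-sided limit requires.\<close>
    have "t\<^sup>2 * (v \<bullet> ((f (x + t *\<^sub>R v) - f x) /\<^sub>R t)) = (x + t *\<^sub>R v - x) \<bullet> (f (x + t *\<^sub>R v) - f x)"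
      using that by (simp add: power2_eq_square)
    also have "\<dots> \<le> \<mu> * (norm (x + t *\<^sub>R v - x))\<^sup>2"
      by (rule lip)
    also have "\<dots> = t\<^sup>2 * (\<mu> * (norm v)\<^sup>2)"
      by (simp add: power_mult_distrib)
    finally show ?thesis
      using that by simp
  qed
  ultimately show ?thesis
    by (intro tendsto_upperbound[where F = "at (0::real)"]) (auto simp: eventually_at_filter)
qed

lemma norm_jacobian_ge:
  fixes f :: "real^'d::finite \<Rightarrow> real^'d"
  assumes lip: "\<And>x y. (x - y) \<bullet> (f x - f y) \<le> \<mu> * (norm (x - y))\<^sup>2"
    and diff: "f differentiable at x" and "\<mu> < 0"
  shows "\<mu>\<^sup>2 \<le> (norm (jacobian f (at x)))\<^sup>2"
proof -
  \<comment> \<open>A single diagonal entry suffices, and an index exists because every type is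
    inhabited.\<close>
  fix k :: 'd
  let ?A = "jacobian f (at x)"
  have "?A $ k $ k = axis k 1 \<bullet> frechet_derivative f (at x) (axis k 1)"
    by (simp add: jacobian_def matrix_def inner_axis')
  also have "\<dots> \<le> \<mu>"
    using one_sided_lipschitz_derivative[OF lip, of "frechet_derivative f (at x)" x "axis k 1"] diff
    by (simp add: frechet_derivative_works)
  finally have "\<bar>\<mu>\<bar> \<le> \<bar>?A $ k $ k\<bar>"
    using \<open>\<mu> < 0\<close> by simp
  also have "\<dots> \<le> norm ?A"
    using component_le_norm_cart[of "?A $ k" k] Finite_Cartesian_Product.norm_nth_le[of ?A k] by simp
  finally show ?thesis
    by (simp flip: abs_le_square_iff)
qed

text \<open>A constant lower bound passes through the expectation because \<open>P\<close> has total
  mass 1, and the supremum dominates its value at time 0.\<close>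

lemma jacobian_moment_ge:
  fixes f :: "real^'d::finite \<Rightarrow> real^'d"
  assumes "prob_space P" and "0 \<le> T"
    and "\<And>x. c \<le> (norm (jacobian f (at x)))\<^sup>2"
  shows "ereal c \<le> jacobian_moment P f T X"
proof (cases "0 \<le> c")
  case True
  interpret prob_space P by fact
  have "ennreal c = (\<integral>\<^sup>+\<omega>. ennreal c \<partial>P)"
    by (simp add: emeasure_space_1)
  also have "\<dots> \<le> (\<integral>\<^sup>+\<omega>. ennreal ((norm (jacobian f (at (X 0 \<omega>))))\<^sup>2) \<partial>P)"
    by (intro nn_integral_mono ennreal_leI assms)
  also have "\<dots> \<le> (SUP t\<in>{0..T}. \<integral>\<^sup>+\<omega>. ennreal ((norm (jacobian f (at (X t \<omega>))))\<^sup>2) \<partial>P)"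
    using \<open>0 \<le> T\<close> by (intro SUP_upper) simp
  finally show ?thesis
    using True by (simp add: jacobian_moment_def less_eq_ennreal.rep_eq enn2ereal_ennreal)
next
  \<comment> \<open>\<open>ennreal\<close> truncates a negative \<open>c\<close> to 0, so this case
    rests on the moment being nonnegative.\<close>
  case False
  then have "ereal c \<le> 0" by simp
  also have "\<dots> \<le> jacobian_moment P f T X"
    by (simp add: jacobian_moment_def)
  finally show ?thesis .
qed

text \<open>The purely real core of the argument. \<open>B\<close> stands for the product of the
  square of \<open>1 - \<theta>\<close> with \<open>M\<close>, once that product is known to be
  finite.\<close>

lemma one_step_factor_bounds:
  fixes \<alpha> \<mu> L \<theta> h B :: real
  assumes "L > 0" and \<alpha>: "\<alpha> = 2 * \<mu> + L" and "\<alpha> < 0" and "0 \<le> \<theta>" and "0 < h"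
    and B: "(1 - \<theta>)\<^sup>2 * \<mu>\<^sup>2 \<le> B" and neg: "\<alpha> + B * h < 0"
  shows "0 < 1 + (\<alpha> + B * h) / (1 - 2 * \<theta> * \<mu> * h) * h"
    and "1 + (\<alpha> + B * h) / (1 - 2 * \<theta> * \<mu> * h) * h < 1"
    and "1 - 2 * \<theta> * \<mu> * h > 0"
proof -
  have "\<mu> < 0" using assms by simp
  then have "\<theta> * \<mu> * h \<le> 0"
    using \<open>0 \<le> \<theta>\<close> \<open>0 < h\<close> by (simp add: mult_le_0_iff)
  then show den: "1 - 2 * \<theta> * \<mu> * h > 0" by simp
  \<comment> \<open>This is the numerator of \<open>beta\<close> over its common denominator, at the
    least admissible \<open>B\<close>, after completing the square. The square can vanish, so
    strictness comes from \<open>L * h\<close>.\<close>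
  have "0 < (1 + (1 - \<theta>) * \<mu> * h)\<^sup>2 + L * h"
    using \<open>L > 0\<close> \<open>0 < h\<close> by (simp add: add_nonneg_pos)
  also have "\<dots> = 1 - 2 * \<theta> * \<mu> * h + (\<alpha> + ((1 - \<theta>)\<^sup>2 * \<mu>\<^sup>2) * h) * h"
    unfolding \<alpha> by (simp add: power2_eq_square algebra_simps)
  also have "\<dots> \<le> 1 - 2 * \<theta> * \<mu> * h + (\<alpha> + B * h) * h"
    using B \<open>0 < h\<close> by (intro add_left_mono mult_right_mono) auto
  finally show "0 < 1 + (\<alpha> + B * h) / (1 - 2 * \<theta> * \<mu> * h) * h"
    using den by (simp add: field_simps)
  show "1 + (\<alpha> + B * h) / (1 - 2 * \<theta> * \<mu> * h) * h < 1"
    using den neg \<open>0 < h\<close> by (simp add: mult_neg_pos divide_neg_pos)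
qed

lemma beta_eq_ereal:
  assumes "ereal ((1 - \<theta>)\<^sup>2) * M = ereal B" and "1 - 2 * \<theta> * \<mu> * h \<noteq> 0"
  shows "beta \<alpha> \<mu> M \<theta> h = ereal (1 + (\<alpha> + B * h) / (1 - 2 * \<theta> * \<mu> * h) * h)"
  using assms by (simp add: beta_def one_ereal_def)

text \<open>Passes from extended to real arithmetic: on the region \<open>beta\<close> is a finite
  number \<open>b\<close>, so the logarithm in \<open>nu\<close> is the ordinary one.\<close>

lemma contractivity_region_beta:
  assumes "L > 0" and \<alpha>: "\<alpha> = 2 * \<mu> + L" and "\<alpha> < 0" and "0 \<le> \<theta>" and "\<theta> \<le> 1"
    and M: "ereal (\<mu>\<^sup>2) \<le> M" and h: "h \<in> contractivity_region \<alpha> M \<theta>"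
  obtains b where "beta \<alpha> \<mu> M \<theta> h = ereal b" and "0 < b" and "b < 1"
proof -
  have "\<mu> < 0" using assms by simp
  have "0 < h"
    using h by (auto simp: contractivity_region_def split: if_splits)
  obtain B where B: "ereal ((1 - \<theta>)\<^sup>2) * M = ereal B" "(1 - \<theta>)\<^sup>2 * \<mu>\<^sup>2 \<le> B" "\<alpha> + B * h < 0"
  proof (cases "\<theta> < 1")
    case False
    \<comment> \<open>Here \<open>\<theta> = 1\<close>, and the convention that 0 times infinity is
      0 gives \<open>B = 0\<close> even for infinite \<open>M\<close>.\<close>
    then show ?thesis
      using that[of 0] \<open>\<theta> \<le> 1\<close> \<open>\<alpha> < 0\<close> by (simp flip: zero_ereal_def)
  next
    case True
    then have h: "ereal h < ereal \<bar>\<alpha>\<bar> / (ereal ((1 - \<theta>)\<^sup>2) * M)"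
      using h by (simp add: contractivity_region_def)
    show ?thesis
    proof (cases M)
      case (real m)
      have "\<mu>\<^sup>2 \<le> m" using M real by simp
      have "0 < \<mu>\<^sup>2" using \<open>\<mu> < 0\<close> by simp
      \<comment> \<open>Positivity of \<open>m\<close> makes the endpoint of the region a genuine
        real quotient; at \<open>m = 0\<close> it would be infinite.\<close>
      then have "0 < m" using \<open>\<mu>\<^sup>2 \<le> m\<close> by (rule less_le_trans)
      then have pos: "0 < (1 - \<theta>)\<^sup>2 * m" using True by simp
      then have "h < \<bar>\<alpha>\<bar> / ((1 - \<theta>)\<^sup>2 * m)"
        using h real True \<open>0 < m\<close> by simp
      then have "(1 - \<theta>)\<^sup>2 * m * h < \<bar>\<alpha>\<bar>"
        using pos by (simp add: pos_less_divide_eq mult.commute)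
      then show ?thesis
        using that[of "(1 - \<theta>)\<^sup>2 * m"] real \<open>\<mu>\<^sup>2 \<le> m\<close> \<open>\<alpha> < 0\<close>
        by (simp add: mult_left_mono)
    next
      case PInf
      \<comment> \<open>For infinite \<open>M\<close> the endpoint is 0, so the region is empty and
        \<open>h\<close> cannot exist.\<close>
      then show ?thesis using h True \<open>0 < h\<close> by simp
    next
      case MInf
      then show ?thesis using M by simp
    qed
  qed
  note bounds = one_step_factor_bounds[OF \<open>L > 0\<close> \<alpha> \<open>\<alpha> < 0\<close> \<open>0 \<le> \<theta>\<close> \<open>0 < h\<close> B(2,3)]
  show ?thesis
    using that[OF beta_eq_ereal[OF B(1)] bounds(1,2)] bounds(3) by simp
qed

theorem mainTheorem3:
  fixes P :: "'w measure"
    and F :: "real \<Rightarrow> 'w measure"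
    and W :: "real \<Rightarrow> 'w \<Rightarrow> real^'m::finite"
    and f :: "real^'d::finite \<Rightarrow> real^'d"
    and g :: "real^'d \<Rightarrow> real^'m^'d"
    and X0 :: "'w \<Rightarrow> real^'d"
    and X :: "real \<Rightarrow> 'w \<Rightarrow> real^'d"
    and T \<mu> L \<alpha> \<theta> :: real
    and M :: ereal
  assumes "wiener_process P F W"
    and "C1 f" and "C1 g"
    and "commutative_noise g"
    and "L > 0"
    and "\<And>x y. (x - y) \<bullet> (f x - f y) \<le> \<mu> * (norm (x - y))\<^sup>2"
    and "\<And>x y. (norm (g x - g y))\<^sup>2 \<le> L * (norm (x - y))\<^sup>2"
    and "\<alpha> = 2 * \<mu> + L" and "\<alpha> < 0"
    and "0 \<le> \<theta>" and "\<theta> \<le> 1"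
    and "T > 0"
    and "integrable P (\<lambda>\<omega>. (norm (X0 \<omega>))\<^sup>2)"
    and "ito_sde_solution P F W f g T X0 X"
    and "M = jacobian_moment P f T X"
  shows "(\<forall>\<Delta>t\<in>contractivity_region \<alpha> M \<theta>. 0 < beta \<alpha> \<mu> M \<theta> \<Delta>t \<and> beta \<alpha> \<mu> M \<theta> \<Delta>t < 1)
       \<and> theta_maruyama_ms_contractive \<alpha> \<mu> M \<theta> (contractivity_region \<alpha> M \<theta>)"
proof -
  interpret wiener_process P F W by fact
  have "\<mu> < 0" using assms(5,8,9) by simp
  \<comment> \<open>\<open>jacobian\<close> is built on a choice operator and is the true derivative
    only at points of differentiability.\<close>
  moreover have "f differentiable at x" for x
    using \<open>C1 f\<close> unfolding C1_def differentiable_def by blast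
  ultimately have "\<mu>\<^sup>2 \<le> (norm (jacobian f (at x)))\<^sup>2" for x
    by (intro norm_jacobian_ge assms(6))
  then have M: "ereal (\<mu>\<^sup>2) \<le> M"
    unfolding \<open>M = jacobian_moment P f T X\<close> using \<open>T > 0\<close>
    by (intro jacobian_moment_ge prob_space_axioms) auto
  note region = contractivity_region_beta[OF assms(5,8,9,10,11) M]
  have beta: "0 < beta \<alpha> \<mu> M \<theta> h \<and> beta \<alpha> \<mu> M \<theta> h < 1" if "h \<in> contractivity_region \<alpha> M \<theta>" for h
    using region[OF that] by (metis ereal_less(2) ereal_less(3))
  have sub: "contractivity_region \<alpha> M \<theta> \<subseteq> {0<..}"
    by (auto simp: contractivity_region_def)
  have "nu \<alpha> \<mu> M \<theta> h < 0" if h: "h \<in> contractivity_region \<alpha> M \<theta>" for h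
  proof -
    from region[OF h] obtain b where b: "beta \<alpha> \<mu> M \<theta> h = ereal b" "0 < b" "b < 1" .
    \<comment> \<open>The logarithm is negative because \<open>b\<close> lies strictly between 0 and
      1, and membership in the region makes \<open>h\<close> positive.\<close>
    then have "1 / h * ln b < 0"
      using sub h by (intro mult_pos_neg) auto
    then show ?thesis
      by (simp add: nu_def ln_ereal_def b(1))
  qed
  with beta sub show ?thesis
    by (simp add: theta_maruyama_ms_contractive_def)
qed

end
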